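(* Let $\mathcal{Q}$ be a nonempty finite set of positive integers with largest element $q$, and let $n\ge1$ and $k\ge0$ be integers. There is a bijection between the set of $k$-element subsets of $\mathbb{N}_n=\{1,2,\ldots,n\}$ each pair $x,y$ of elements of which satisfies $|x-y|\notin\mathcal{Q}$ and the set of restricted-overlap tilings of an $(n+q)$-board that use squares and exactly $k$ combs corresponding to $\mathcal{Q}$.
   Context: An $N$-board is a linear array of $N$ unit square cells, numbered $1,\ldots,N$ from left to right. A square is a $1\times1$ tile. The comb corresponding to $\mathcal{Q}$ (where $q=\max\mathcal{Q}$) is a tile of length $q+1$ with cells numbered $0,1,\ldots,q$ from left to right, in which cell $0$ is filled and cell $i$ ($1\le i\le q$) is filled if and only if $i\in\mathcal{Q}$; unfilled cells are gaps and are not part of the tile. A restricted-overlap tiling of a board is a placement of tiles on the board (each tile lying entirely within the board) such that every cell of the board is covered by a filled cell of at least one tile, and the leftmost cell of each tile is not covered by any other tile; filled cells that are not the leftmost cells of their tiles are allowed to overlap one another. A tiling is determined by which tiles are placed at which positions. *)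

theory Defs imports Main
begin

datatype tile = Square | Comb

fun tile_length :: "nat set \<Rightarrow> tile \<Rightarrow> nat" where
  "tile_length Q Square = 1"
| "tile_length Q Comb = Max Q + 1"

text \<open>Filled cells of a tile, numbered from 0 at the left end of the tile.\<close>

fun filled_cells :: "nat set \<Rightarrow> tile \<Rightarrow> nat set" where
  "filled_cells Q Square = {0}"
| "filled_cells Q Comb = insert 0 Q"

text \<open>A placed tile is a pair of a tile and the board cell occupied by its leftmost cell.
  A tiling is a set of placed tiles. No multiplicities are needed: two copies of
  the same tile at the same position would cover each other's leftmost cell.\<close>

definition covered_cells :: "nat set \<Rightarrow> tile \<times> nat \<Rightarrow> nat set" where
  "covered_cells Q = (\<lambda>(t, p). (\<lambda>i. p + i) ` filled_cells Q t)"

text \<open>The tile with all its cells, including the gaps, must lie within the board.\<close>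

definition within_board :: "nat set \<Rightarrow> nat \<Rightarrow> tile \<times> nat \<Rightarrow> bool" where
  "within_board Q N = (\<lambda>(t, p). {p..<p + tile_length Q t} \<subseteq> {1..N})"

definition restricted_overlap_tiling ::
    "nat set \<Rightarrow> nat \<Rightarrow> (tile \<times> nat) set \<Rightarrow> bool" where
  "restricted_overlap_tiling Q N T \<longleftrightarrow>
     (\<forall>a\<in>T. within_board Q N a) \<and>
     (\<forall>c\<in>{1..N}. \<exists>a\<in>T. c \<in> covered_cells Q a) \<and>
     (\<forall>a\<in>T. \<forall>b\<in>T. a \<noteq> b \<longrightarrow> snd a \<notin> covered_cells Q b)"

definition num_combs :: "(tile \<times> nat) set \<Rightarrow> nat" where
  "num_combs T = card {a \<in> T. fst a = Comb}"

end

theory Submission imports Defs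
begin

text \<open>The combs of a tiling are placed at the elements of the subset. The squares are then forced:
  each cell not covered by a comb needs a square, and a square may not lie on any other tile.\<close>

definition comb_cells :: "nat set \<Rightarrow> nat set \<Rightarrow> nat set" where
  "comb_cells Q S = (\<Union>p\<in>S. covered_cells Q (Comb, p))"

definition tiling_of :: "nat set \<Rightarrow> nat \<Rightarrow> nat set \<Rightarrow> (tile \<times> nat) set" where
  "tiling_of Q N S = Pair Comb ` S \<union> Pair Square ` ({1..N} - comb_cells Q S)"

text \<open>This is to be the inverse map: a tiling is recovered from its combs alone.\<close>

definition comb_positions :: "(tile \<times> nat) set \<Rightarrow> nat set" where
  "comb_positions T = {p. (Comb, p) \<in> T}"

lemma covered_cells_Square [simp]: "covered_cells Q (Square, p) = {p}"
  by (simp add: covered_cells_def)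

lemma mem_covered_cells_Comb [simp]:
  "c \<in> covered_cells Q (Comb, p) \<longleftrightarrow> c = p \<or> (\<exists>i\<in>Q. c = p + i)"
  by (auto simp: covered_cells_def)

lemma within_board_Square [simp]: "within_board Q N (Square, p) \<longleftrightarrow> p \<in> {1..N}"
  by (auto simp: within_board_def)

text \<open>A comb has positive length, so its interval lies in the board as soon as its two end
  cells \<open>p\<close> and \<open>p + Max Q\<close> do.\<close>

lemma within_board_Comb [simp]:
  "within_board Q N (Comb, p) \<longleftrightarrow> 1 \<le> p \<and> p + Max Q \<le> N"
proof -
  have "{p..<p + (Max Q + 1)} = {p..p + Max Q}"
    by auto
  then show ?thesis
    by (auto simp: within_board_def)
qed

lemma num_combs_eq_card_comb_positions: "num_combs T = card (comb_positions T)"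
proof -
  have "{a \<in> T. fst a = Comb} = Pair Comb ` comb_positions T"
    by (force simp: comb_positions_def)
  then show ?thesis
    by (simp add: num_combs_def card_image inj_on_def)
qed

lemma comb_positions_tiling_of [simp]: "comb_positions (tiling_of Q N S) = S"
  by (auto simp: comb_positions_def tiling_of_def)

text \<open>Links the distance condition to covering: \<open>x = y + i\<close> with \<open>i\<close>
  in \<open>Q\<close> says that a comb at \<open>y\<close> has a filled cell at
  \<open>x\<close>.\<close>

lemma abs_diff_mem_int_image_iff:
  "\<bar>int x - int y\<bar> \<in> int ` Q \<longleftrightarrow> (\<exists>i\<in>Q. x = y + i \<or> y = x + i)"
proof
  assume "\<bar>int x - int y\<bar> \<in> int ` Q"
  then obtain i where i: "i \<in> Q" "\<bar>int x - int y\<bar> = int i"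
    by auto
  from i(2) have "x = y + i \<or> y = x + i"
    by linarith
  with i(1) show "\<exists>i\<in>Q. x = y + i \<or> y = x + i"
    by blast
next
  assume "\<exists>i\<in>Q. x = y + i \<or> y = x + i"
  then show "\<bar>int x - int y\<bar> \<in> int ` Q"
    by (auto simp: image_iff)
qed

lemma restricted_overlap_tilingD:
  assumes "restricted_overlap_tiling Q N T"
  shows "a \<in> T \<Longrightarrow> within_board Q N a"
    and "c \<in> {1..N} \<Longrightarrow> \<exists>a\<in>T. c \<in> covered_cells Q a"
    \<comment> \<open>The overlap condition in contrapositive form: only a tile itself covers its
      leftmost cell.\<close>
    and "(t, p) \<in> T \<Longrightarrow> b \<in> T \<Longrightarrow> p \<in> covered_cells Q b \<Longrightarrow> b = (t, p)"
proof -
  show "a \<in> T \<Longrightarrow> within_board Q N a"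
    using assms unfolding restricted_overlap_tiling_def by blast
  show "c \<in> {1..N} \<Longrightarrow> \<exists>a\<in>T. c \<in> covered_cells Q a"
    using assms unfolding restricted_overlap_tiling_def by blast
  show "b = (t, p)" if "(t, p) \<in> T" "b \<in> T" "p \<in> covered_cells Q b"
  proof (rule ccontr)
    assume neq: "b \<noteq> (t, p)"
    have "\<forall>a\<in>T. \<forall>b\<in>T. a \<noteq> b \<longrightarrow> snd a \<notin> covered_cells Q b"
      using assms unfolding restricted_overlap_tiling_def by (elim conjE)
    from this[rule_format, OF that(1,2) neq[symmetric]] that(3) show False
      by simp
  qed
qed

text \<open>Combs at positions up to \<open>n\<close> end by cell \<open>n + Max Q\<close>, and
  squares fill whatever the combs leave uncovered.\<close>

lemma restricted_overlap_tiling_tiling_of: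
  assumes S: "S \<subseteq> {1..n}"
    and diff: "\<forall>x\<in>S. \<forall>y\<in>S. \<bar>int x - int y\<bar> \<notin> int ` Q"
  shows "restricted_overlap_tiling Q (n + Max Q) (tiling_of Q (n + Max Q) S)"
  unfolding restricted_overlap_tiling_def
proof (intro conjI ballI impI)
  fix a assume "a \<in> tiling_of Q (n + Max Q) S"
  with S show "within_board Q (n + Max Q) a"
    by (auto simp: tiling_of_def)
next
  fix c assume "c \<in> {1..n + Max Q}"
  then show "\<exists>a\<in>tiling_of Q (n + Max Q) S. c \<in> covered_cells Q a"
    by (cases "c \<in> comb_cells Q S") (auto simp: tiling_of_def comb_cells_def bex_Un)
next
  fix a b
  assume "a \<in> tiling_of Q (n + Max Q) S" "b \<in> tiling_of Q (n + Max Q) S" "a \<noteq> b"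
  \<comment> \<open>Two distinct combs meeting at a leftmost cell would differ in position by an
    element of \<open>Q\<close>. Squares avoid \<open>comb_cells Q S\<close>, which includes the
    leftmost cells of the combs.\<close>
  with diff show "snd a \<notin> covered_cells Q b"
    by (auto simp: tiling_of_def comb_cells_def abs_diff_mem_int_image_iff)
qed

text \<open>The \<open>Max Q\<close> extra cells of the board are exactly what a comb needs to the
  right of its leftmost cell.\<close>

lemma comb_positions_subset:
  assumes "restricted_overlap_tiling Q (n + Max Q) T"
  shows "comb_positions T \<subseteq> {1..n}"
proof
  fix p assume "p \<in> comb_positions T"
  then have "within_board Q (n + Max Q) (Comb, p)"
    using restricted_overlap_tilingD(1)[OF assms] unfolding comb_positions_def by blast
  then show "p \<in> {1..n}"
    by simp
qed

text \<open>If two positions differed by an element of \<open>Q\<close>, the left comb would cover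
  the leftmost cell of the right one.\<close>

lemma comb_positions_diff:
  assumes tiling: "restricted_overlap_tiling Q N T" and pos: "\<forall>i\<in>Q. 0 < i"
    and "x \<in> comb_positions T" "y \<in> comb_positions T"
  shows "\<bar>int x - int y\<bar> \<notin> int ` Q"
proof -
  have "x \<noteq> y + i" if "(Comb, x) \<in> T" "(Comb, y) \<in> T" "i \<in> Q" for x y i
  proof
    assume "x = y + i"
    \<comment> \<open>Positivity makes the two combs distinct tiles; a comb may cover its own
      leftmost cell.\<close>
    with pos that(3) have "x \<noteq> y"
      by force
    moreover have "x \<in> covered_cells Q (Comb, y)"
      using \<open>x = y + i\<close> that(3) by auto
    ultimately show False
      using restricted_overlap_tilingD(3)[OF tiling that(1,2)] by simp
  qed
  with assms(3,4) show ?thesis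
    by (auto simp: comb_positions_def abs_diff_mem_int_image_iff)
qed

text \<open>The combs agree by construction, so only the squares need an argument.\<close>

lemma tiling_of_comb_positions:
  assumes tiling: "restricted_overlap_tiling Q N T"
  shows "tiling_of Q N (comb_positions T) = T"
proof -
  have squares: "(Square, c) \<in> T \<longleftrightarrow> c \<in> {1..N} - comb_cells Q (comb_positions T)" for c
  proof
    assume c: "(Square, c) \<in> T"
    have "c \<in> {1..N}"
      using restricted_overlap_tilingD(1)[OF tiling c] by simp
    \<comment> \<open>A comb covering \<open>c\<close> would have to equal the square at
      \<open>c\<close>.\<close>
    moreover have "c \<notin> comb_cells Q (comb_positions T)"
      using restricted_overlap_tilingD(3)[OF tiling c]
      unfolding comb_cells_def comb_positions_def by blast
    ultimately show "c \<in> {1..N} - comb_cells Q (comb_positions T)"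
      by simp
  next
    assume c: "c \<in> {1..N} - comb_cells Q (comb_positions T)"
    then obtain t p where "(t, p) \<in> T" "c \<in> covered_cells Q (t, p)"
      using restricted_overlap_tilingD(2)[OF tiling, of c] by force
    \<comment> \<open>The tile covering \<open>c\<close> is no comb, and a square covers only its
      own position.\<close>
    with c show "(Square, c) \<in> T"
      by (cases t) (auto simp: comb_cells_def comb_positions_def)
  qed
  have "a \<in> tiling_of Q N (comb_positions T) \<longleftrightarrow> a \<in> T" for a
  proof (cases a)
    case (Pair t p)
    show ?thesis
    proof (cases t)
      case Square
      then show ?thesis
        unfolding Pair Square squares by (simp add: tiling_of_def image_iff)
    next
      case Comb
      then show ?thesis
        unfolding Pair Comb by (simp add: tiling_of_def image_iff comb_positions_def)
    qed
  qed
  then show ?thesis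
    by (rule set_eqI)
qed

theorem theorem1:
  fixes Q :: "nat set" and q n k :: nat
  assumes "finite Q" and "Q \<noteq> {}" and "\<forall>i\<in>Q. 0 < i"
    and "q = Max Q" and "1 \<le> n"
  shows "\<exists>f. bij_betw f
      {S. S \<subseteq> {1..n} \<and> card S = k \<and>
          (\<forall>x\<in>S. \<forall>y\<in>S. \<bar>int x - int y\<bar> \<notin> int ` Q)}
      {T. restricted_overlap_tiling Q (n + q) T \<and> num_combs T = k}"
proof -
  have "bij_betw (tiling_of Q (n + Max Q))
      {S. S \<subseteq> {1..n} \<and> card S = k \<and>
          (\<forall>x\<in>S. \<forall>y\<in>S. \<bar>int x - int y\<bar> \<notin> int ` Q)}
      {T. restricted_overlap_tiling Q (n + Max Q) T \<and> num_combs T = k}"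
    (is "bij_betw _ ?S ?T")
  \<comment> \<open>The two maps are mutually inverse, and \<open>num_combs\<close> of a tiling is
    the cardinality of its comb positions, so \<open>k\<close> is preserved both ways.\<close>
  proof (rule bij_betw_byWitness[where f' = comb_positions])
    show "\<forall>S\<in>?S. comb_positions (tiling_of Q (n + Max Q) S) = S"
      by simp
    show "\<forall>T\<in>?T. tiling_of Q (n + Max Q) (comb_positions T) = T"
      by (simp add: tiling_of_comb_positions)
    show "tiling_of Q (n + Max Q) ` ?S \<subseteq> ?T"
      using restricted_overlap_tiling_tiling_of
      by (auto simp: num_combs_eq_card_comb_positions)
    show "comb_positions ` ?T \<subseteq> ?S"
    proof (rule image_subsetI)
      fix T assume "T \<in> ?T"
      then show "comb_positions T \<in> ?S"
        using comb_positions_subset[of Q n T]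
          comb_positions_diff[OF _ assms(3), of "n + Max Q" T]
        by (simp add: num_combs_eq_card_comb_positions)
    qed
  qed
  with assms(4) show ?thesis
    by blast
qed

end
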